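(* Let $m,n,l\ge 1$ be integers, let $\mathcal X=\{\mathbf x^{(1)},\dots,\mathbf x^{(l)}\}\subset\mathbb R^n$ and $\mathcal Y=\{\mathbf y^{(1)},\dots,\mathbf y^{(l)}\}\subset\mathbb R^m$ be given, and let $c_3^{(s)}$ be a finite positive real number. Let $G\in\mathbb R^{m\times n}$, $u^{(4)}\in\mathbb R$, $\mathbf u^{(2)}\in\mathbb R^m$, $\mathbf h\in\mathbb R^n$ have i.i.d. standard normal components and be independent of each other. Then $$\log\mathbb E_{G,u^{(4)}}\,e^{c_3^{(s)}\max_{\mathbf x^{(i_1)}\in\mathcal X}\min_{\mathbf y^{(i_2)}\in\mathcal Y}\left((\mathbf y^{(i_2)})^TG\mathbf x^{(i_1)}+\|\mathbf x^{(i_1)}\|_2\|\mathbf y^{(i_2)}\|_2u^{(4)}\right)}\ \le\ \log\mathbb E_{\mathbf u^{(2)},\mathbf h}\,e^{c_3^{(s)}\max_{\mathbf x^{(i_1)}\in\mathcal X}\min_{\mathbf y^{(i_2)}\in\mathcal Y}\left(\|\mathbf x^{(i_1)}\|_2(\mathbf y^{(i_2)})^T\mathbf u^{(2)}+\|\mathbf y^{(i_2)}\|_2\mathbf h^T\mathbf x^{(i_1)}\right)}.$$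
   Context: The superscript in $c_3^{(s)}$ is only a label. $\mathbb E$ denotes expectation over the variables in its subscript. *)

theory Defs
  imports "HOL-Probability.Probability"
begin

text \<open>
  The scalar components of \<open>G\<close>, \<open>u\<^sub>4\<close>, \<open>u\<^sub>2\<close> and \<open>h\<close> are collected in a single family,
  because \<^const>\<open>prob_space.indep_vars\<close> needs all its variables to have the same codomain.
  Independence of that family says both that each of the four objects has independent
  components and that the four objects are mutually independent.
\<close>

datatype ('m, 'n) component_index = Ix_G 'm 'n | Ix_u4 | Ix_u2 'm | Ix_h 'n

primrec component ::
  "('w \<Rightarrow> real ^ 'n ^ 'm) \<Rightarrow> ('w \<Rightarrow> real) \<Rightarrow> ('w \<Rightarrow> real ^ 'm) \<Rightarrow> ('w \<Rightarrow> real ^ 'n)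
    \<Rightarrow> ('m, 'n) component_index \<Rightarrow> 'w \<Rightarrow> real"
where
  "component G u4 u2 h (Ix_G i j) = (\<lambda>w. G w $ i $ j)"
| "component G u4 u2 h Ix_u4 = u4"
| "component G u4 u2 h (Ix_u2 i) = (\<lambda>w. u2 w $ i)"
| "component G u4 u2 h (Ix_h j) = (\<lambda>w. h w $ j)"

definition iid_std_normal :: "'w measure \<Rightarrow> ('i \<Rightarrow> 'w \<Rightarrow> real) \<Rightarrow> bool" where
  "iid_std_normal M Z \<longleftrightarrow>
     prob_space.indep_vars M (\<lambda>_. borel) Z UNIV \<and>
     (\<forall>i. distributed M lborel (Z i) std_normal_density)"

end

(* Gordon's comparison by Gaussian interpolation. Both index families are linear images of one
   standard Gaussian vector, along coefficients alpha (G and u4) and gamma (u2 and h) with disjoint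
   supports. Their covariances agree within a row and differ by
   (|a||a'| - a.a') (|b||b'| - b.b') >= 0 across rows. Along the path sin t * alpha + cos t * gamma
   the expectation of a smooth F has derivative
   sin t cos t * sum over i, j of E[F_ij] (Cov_alpha - Cov_gamma)_ij, by Stein's identity.
   The function exp (- K * sum_a exp (- sum_b exp (- beta (z_ab - tau)))) has nonnegative mixed
   derivatives across rows and tends to the indicator of max_a min_b z_ab < tau as K = beta -> infinity,
   so the max-min of the alpha family is stochastically smaller; a layer-cake argument passes
   to exponential moments. *)
theory Submission
  imports Defs "HOL-Real_Asymp.Real_Asymp"
begin

subsection \<open>Stein's identity\<close>

abbreviation std_normal :: "real measure" where
  "std_normal \<equiv> density lborel (\<lambda>x. ennreal (std_normal_density x))"

lemma prob_space_std_normal: "prob_space std_normal"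
  using prob_space_normal_density[of 1 0] by simp

lemma std_normal_density_deriv:
  "(std_normal_density has_real_derivative (- x * std_normal_density x)) (at x)"
  unfolding std_normal_density_def
  by (auto intro!: derivative_eq_intros simp: field_simps)

lemma std_normal_density_tendsto:
  "(std_normal_density \<longlongrightarrow> 0) at_top" "(std_normal_density \<longlongrightarrow> 0) at_bot"
  unfolding std_normal_density_def by real_asymp+

lemma integrable_std_normal_id: "integrable std_normal (\<lambda>x. x)"
  using integrable_std_normal_moment[of 1]
  by (subst integrable_density) auto

text \<open>Integration by parts: the density \<open>?d\<close> satisfies
  \<open>?d' x = - x * ?d x\<close>, so \<open>(x * f x - f' x) * ?d x\<close> is the derivative of
  \<open>- (f x * ?d x)\<close>, which vanishes at both infinities because \<open>f\<close> is
  bounded.\<close>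

lemma stein_identity:
  fixes f f' :: "real \<Rightarrow> real"
  assumes der: "\<And>x. (f has_real_derivative f' x) (at x)"
    and cont: "\<And>x. isCont f' x"
    and bd: "\<And>x. \<bar>f x\<bar> \<le> C" "\<And>x. \<bar>f' x\<bar> \<le> C"
  shows "(\<integral>x. x * f x \<partial>std_normal) = (\<integral>x. f' x \<partial>std_normal)"
proof -
  let ?d = std_normal_density
  interpret N: prob_space std_normal by (rule prob_space_std_normal)
  have contf: "isCont f x" for x using der DERIV_isCont by blast
  have [measurable]: "f \<in> borel_measurable borel" "f' \<in> borel_measurable borel"
    using contf cont by (auto intro!: borel_measurable_continuous_onI continuous_at_imp_continuous_on)
  have if': "integrable std_normal f'"
    using bd(2) by (intro N.integrable_const_bound[where B=C]) auto
  have ixf: "integrable std_normal (\<lambda>x. x * f x)"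
  proof (rule Bochner_Integration.integrable_bound)
    show "integrable std_normal (\<lambda>x. C * x)"
      using integrable_std_normal_id by auto
    have "\<bar>x\<bar> * \<bar>f x\<bar> \<le> \<bar>C\<bar> * \<bar>x\<bar>" for x
      using mult_left_mono[OF order_trans[OF bd(1)[of x] abs_ge_self] abs_ge_zero[of x]]
      by (simp add: mult.commute)
    then show "AE x in std_normal. norm (x * f x) \<le> norm (C * x)"
      by (auto simp: abs_mult)
  qed auto
  have iall: "integrable lborel (\<lambda>x. ?d x * (x * f x) - ?d x * f' x)"
    using ixf if' by (subst (asm) (1 2) integrable_density) auto
  let ?F = "\<lambda>x. - (f x * ?d x)"
  have lim: "(?F \<longlongrightarrow> 0) at_top" "(?F \<longlongrightarrow> 0) at_bot"
  proof -
    have b: "\<bar>?F x\<bar> \<le> C * ?d x" for x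
      using mult_right_mono[OF bd(1)[of x], of "?d x"] by (simp add: abs_mult)
    show "(?F \<longlongrightarrow> 0) at_top"
      by (rule Lim_null_comparison[where g="\<lambda>x. C * ?d x"])
        (use b std_normal_density_tendsto tendsto_mult_right_zero in auto)
    show "(?F \<longlongrightarrow> 0) at_bot"
      by (rule Lim_null_comparison[where g="\<lambda>x. C * ?d x"])
        (use b std_normal_density_tendsto tendsto_mult_right_zero in auto)
  qed
  have "(LBINT x=-\<infinity>..\<infinity>. ?d x * (x * f x) - ?d x * f' x) = 0 - 0"
  proof (rule interval_integral_FTC_integrable[where F="?F"])
    show "(?F has_vector_derivative ?d x * (x * f x) - ?d x * f' x) (at x)" for x
      unfolding has_real_derivative_iff_has_vector_derivative[symmetric]
      by (rule derivative_eq_intros der std_normal_density_deriv refl)+ (simp add: algebra_simps)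
    show "isCont (\<lambda>x. ?d x * (x * f x) - ?d x * f' x) x" for x
      using contf cont DERIV_isCont[OF std_normal_density_deriv] by (intro continuous_intros) auto
    show "set_integrable lborel (einterval (-\<infinity>) \<infinity>) (\<lambda>x. ?d x * (x * f x) - ?d x * f' x)"
      using iall by (simp add: set_integrable_def einterval_def)
    show "((?F \<circ> real_of_ereal) \<longlongrightarrow> 0) (at_right (-\<infinity>))"
      "((?F \<circ> real_of_ereal) \<longlongrightarrow> 0) (at_left \<infinity>)"
      using lim by (simp_all add: ereal_tendsto_simps)
  qed auto
  then have "(\<integral>x. ?d x * (x * f x) - ?d x * f' x \<partial>lborel) = 0"
    by (simp add: interval_lebesgue_integral_def set_lebesgue_integral_def einterval_def)
  moreover have "integrable lborel (\<lambda>x. ?d x * (x * f x))" "integrable lborel (\<lambda>x. ?d x * f' x)"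
    using ixf if' by (subst (asm) (1 2) integrable_density; auto)+
  ultimately show ?thesis
    by (subst (1 2) integral_density) auto
qed

section \<open>Standard Gaussian vectors and Stein's identity in one coordinate\<close>

abbreviation std_normal_vec :: "'s set \<Rightarrow> ('s \<Rightarrow> real) measure" where
  "std_normal_vec S \<equiv> Pi\<^sub>M S (\<lambda>_. std_normal)"

lemma product_sigma_finite_std_normal: "product_sigma_finite (\<lambda>_. std_normal)"
  by (simp add: product_sigma_finite_def prob_space_std_normal prob_space_imp_sigma_finite)

lemma prob_space_std_normal_vec: "prob_space (std_normal_vec S)"
  by (intro prob_space_PiM prob_space_std_normal)

lemma integrable_std_normal_vec_component:
  assumes "s \<in> S" and "integrable std_normal f"
  shows "integrable (std_normal_vec S) (\<lambda>g. f (g s) :: real)"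
proof -
  have "distr (std_normal_vec S) std_normal (\<lambda>g. g s) = std_normal"
    using assms by (intro distr_PiM_component prob_space_std_normal)
  then show ?thesis
    using assms integrable_distr[of "\<lambda>g. g s" "std_normal_vec S" std_normal f] by auto
qed

text \<open>By Fubini the coordinate \<open>s\<close> is integrated first with the others frozen,
  where the one-dimensional identity applies. The hypotheses use \<open>g(s := t)\<close> because
  \<open>product_integral_insert\<close> presents the inner integrand in that form.\<close>

lemma stein_identity_vec:
  fixes f f' :: "('s \<Rightarrow> real) \<Rightarrow> real"
  assumes S: "finite S" "s \<in> S"
    and [measurable]: "f \<in> borel_measurable (std_normal_vec S)" "f' \<in> borel_measurable (std_normal_vec S)"
    and der: "\<And>g t. ((\<lambda>t. f (g(s := t))) has_real_derivative f' (g(s := t))) (at t)"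
    and cont: "\<And>g t. isCont (\<lambda>t. f' (g(s := t))) t"
    and bd: "\<And>g. \<bar>f g\<bar> \<le> C" "\<And>g. \<bar>f' g\<bar> \<le> C"
  shows "(\<integral>g. g s * f g \<partial>std_normal_vec S) = (\<integral>g. f' g \<partial>std_normal_vec S)"
proof -
  interpret product_sigma_finite "\<lambda>_::'s. std_normal" by (rule product_sigma_finite_std_normal)
  interpret P: prob_space "std_normal_vec S" by (rule prob_space_std_normal_vec)
  have ins: "insert s (S - {s}) = S" using S by auto
  have i1: "integrable (std_normal_vec S) (\<lambda>g. g s)"
    using integrable_std_normal_vec_component[OF S(2) integrable_std_normal_id] .
  have [measurable]: "(\<lambda>g. g s) \<in> borel_measurable (std_normal_vec S)"
    using i1 by auto
  have if': "integrable (std_normal_vec S) f'"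
    using bd(2) by (intro P.integrable_const_bound[where B=C]) auto
  have if1: "integrable (std_normal_vec S) (\<lambda>g. g s * f g)"
  proof (rule Bochner_Integration.integrable_bound)
    show "integrable (std_normal_vec S) (\<lambda>g. C * g s)"
      using i1 by auto
    have "\<bar>g s\<bar> * \<bar>f g\<bar> \<le> \<bar>C\<bar> * \<bar>g s\<bar>" for g
      using mult_left_mono[OF order_trans[OF bd(1)[of g] abs_ge_self] abs_ge_zero[of "g s"]]
      by (simp add: mult.commute)
    then show "AE g in std_normal_vec S. norm (g s * f g) \<le> norm (C * g s)"
      by (auto simp: abs_mult)
  qed auto
  have "(\<integral>g. g s * f g \<partial>std_normal_vec S)
      = (\<integral>g. (\<integral>t. t * f (g(s := t)) \<partial>std_normal) \<partial>std_normal_vec (S - {s}))"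
    using product_integral_insert[of "S - {s}" s "\<lambda>g. g s * f g", unfolded ins] S if1 by simp
  also have "\<dots> = (\<integral>g. (\<integral>t. f' (g(s := t)) \<partial>std_normal) \<partial>std_normal_vec (S - {s}))"
    using stein_identity[OF der cont bd] by simp
  also have "\<dots> = (\<integral>g. f' g \<partial>std_normal_vec S)"
    using product_integral_insert[of "S - {s}" s f', unfolded ins] S if' by simp
  finally show ?thesis .
qed


lemma measurable_std_normal_vec_component:
  "s \<in> S \<Longrightarrow> (\<lambda>g. g s) \<in> borel_measurable (std_normal_vec S)"
  using borel_measurable_integrable[OF integrable_std_normal_vec_component[OF _ integrable_std_normal_id]] .

subsection \<open>Gaussian interpolation\<close>

lemma measurable_compose_family:
  assumes "F \<in> borel_measurable (Pi\<^sub>M UNIV (\<lambda>_. borel))"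
    and "\<And>i. (\<lambda>w. z w i) \<in> borel_measurable M"
  shows "(\<lambda>w. F (z w)) \<in> borel_measurable M"
proof (rule measurable_compose[OF _ assms(1)])
  show "z \<in> measurable M (Pi\<^sub>M UNIV (\<lambda>_. borel))"
    using measurable_PiM_single'[of UNIV "\<lambda>i w. z w i" M "\<lambda>_. borel"] assms(2) by auto
qed

text \<open>The derivative hypotheses are chain rules along arbitrary curves; they stand in for a
  differentiable structure on the function space, and both the path in the angle and the variation
  of a single Gaussian coordinate are instances. Both processes are images of one Gaussian vector,
  and \<open>orth\<close> makes them uncorrelated.\<close>

lemma gaussian_interpolation:
  fixes F :: "('i \<Rightarrow> real) \<Rightarrow> real" and \<alpha> \<beta> :: "'i \<Rightarrow> 's \<Rightarrow> real"
  assumes fin: "finite S" "finite I"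
    and dF: "\<And>c c' t. (\<And>i. i \<in> I \<Longrightarrow> ((\<lambda>t. c t i) has_real_derivative c' i) (at t)) \<Longrightarrow>
      ((\<lambda>t. F (c t)) has_real_derivative (\<Sum>i\<in>I. F' i (c t) * c' i)) (at t)"
    and dF': "\<And>i c c' t. i \<in> I \<Longrightarrow> (\<And>j. j \<in> I \<Longrightarrow> ((\<lambda>t. c t j) has_real_derivative c' j) (at t)) \<Longrightarrow>
      ((\<lambda>t. F' i (c t)) has_real_derivative (\<Sum>j\<in>I. F'' i j (c t) * c' j)) (at t)"
    and cF'': "\<And>i j (c :: real \<Rightarrow> 'i \<Rightarrow> real) t. i \<in> I \<Longrightarrow> j \<in> I \<Longrightarrow> (\<And>k. k \<in> I \<Longrightarrow> isCont (\<lambda>t. c t k) t) \<Longrightarrow>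
      isCont (\<lambda>t. F'' i j (c t)) t"
    and meas: "F \<in> borel_measurable (Pi\<^sub>M UNIV (\<lambda>_. borel))"
      "\<And>i. i \<in> I \<Longrightarrow> F' i \<in> borel_measurable (Pi\<^sub>M UNIV (\<lambda>_. borel))"
      "\<And>i j. i \<in> I \<Longrightarrow> j \<in> I \<Longrightarrow> F'' i j \<in> borel_measurable (Pi\<^sub>M UNIV (\<lambda>_. borel))"
    and bd: "\<And>z. \<bar>F z\<bar> \<le> C" "\<And>i z. i \<in> I \<Longrightarrow> \<bar>F' i z\<bar> \<le> C"
      "\<And>i j z. i \<in> I \<Longrightarrow> j \<in> I \<Longrightarrow> \<bar>F'' i j z\<bar> \<le> C"
    and orth: "\<And>i j. i \<in> I \<Longrightarrow> j \<in> I \<Longrightarrow> (\<Sum>s\<in>S. \<alpha> i s * \<beta> j s) = 0"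
    and pos: "\<And>i j z. i \<in> I \<Longrightarrow> j \<in> I \<Longrightarrow>
      0 \<le> F'' i j z * ((\<Sum>s\<in>S. \<alpha> i s * \<alpha> j s) - (\<Sum>s\<in>S. \<beta> i s * \<beta> j s))"
  shows "(\<integral>g. F (\<lambda>i. \<Sum>s\<in>S. \<beta> i s * g s) \<partial>std_normal_vec S)
      \<le> (\<integral>g. F (\<lambda>i. \<Sum>s\<in>S. \<alpha> i s * g s) \<partial>std_normal_vec S)"
proof -
  let ?P = "std_normal_vec S" and ?J = "{0..pi/2}"
  interpret P: prob_space ?P by (rule prob_space_std_normal_vec)
  interpret LP: pair_sigma_finite lborel ?P ..
  define A where "A i g = (\<Sum>s\<in>S. \<alpha> i s * g s)" for i and g :: "'s \<Rightarrow> real"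
  define B where "B i g = (\<Sum>s\<in>S. \<beta> i s * g s)" for i and g :: "'s \<Rightarrow> real"
  \<comment> \<open>The path leads from \<open>B\<close> at angle 0 to \<open>A\<close> at angle
    \<open>pi/2\<close>; \<open>V\<close> is its velocity and \<open>D\<close> the resulting
    derivative of \<open>F\<close> along it.\<close>
  define Z where "Z \<theta> g = (\<lambda>i. sin \<theta> * A i g + cos \<theta> * B i g)" for \<theta> g
  define V where "V \<theta> i g = cos \<theta> * A i g - sin \<theta> * B i g" for \<theta> i g
  define D where "D \<theta> g = (\<Sum>i\<in>I. F' i (Z \<theta> g) * V \<theta> i g)" for \<theta> g
  have comp[measurable]: "(\<lambda>g. g s) \<in> borel_measurable ?P" if "s \<in> S" for s
    using that by (rule measurable_std_normal_vec_component)
  have mAB[measurable]: "A i \<in> borel_measurable ?P" "B i \<in> borel_measurable ?P" for i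
    unfolding A_def[abs_def] B_def[abs_def] by measurable
  have mF: "(\<lambda>g. F (\<lambda>i. A i g)) \<in> borel_measurable ?P" "(\<lambda>g. F (\<lambda>i. B i g)) \<in> borel_measurable ?P"
    by (rule measurable_compose_family[OF meas(1)], rule mAB)+
  have mF'[measurable]: "(\<lambda>p. F' i (Z (fst p) (snd p))) \<in> borel_measurable (lborel \<Otimes>\<^sub>M ?P)"
    if "i \<in> I" for i
    using that unfolding Z_def by (intro measurable_compose_family[OF meas(2)]) measurable
  have mF'1[measurable]: "(\<lambda>g. F' i (Z \<theta> g)) \<in> borel_measurable ?P" if "i \<in> I" for i \<theta>
    using that unfolding Z_def by (intro measurable_compose_family[OF meas(2)]) measurable
  have mF''1[measurable]: "(\<lambda>g. F'' i j (Z \<theta> g)) \<in> borel_measurable ?P" if "i \<in> I" "j \<in> I" for i j \<theta>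
    using that unfolding Z_def by (intro measurable_compose_family[OF meas(3)]) measurable
  have mD[measurable]: "(\<lambda>p. D (fst p) (snd p)) \<in> borel_measurable (lborel \<Otimes>\<^sub>M ?P)"
    unfolding D_def V_def by measurable
  have igs: "integrable ?P (\<lambda>g. g s)" if "s \<in> S" for s
    using integrable_std_normal_vec_component[OF that integrable_std_normal_id] .
  have iAB: "integrable ?P (\<lambda>g. \<bar>A i g\<bar>)" "integrable ?P (\<lambda>g. \<bar>B i g\<bar>)" for i
    unfolding A_def B_def using igs by (auto intro!: Bochner_Integration.integrable_sum)

  have V_le: "\<bar>V \<theta> i g\<bar> \<le> \<bar>A i g\<bar> + \<bar>B i g\<bar>" for \<theta> i g
  proof -
    have "\<bar>V \<theta> i g\<bar> \<le> \<bar>cos \<theta>\<bar> * \<bar>A i g\<bar> + \<bar>sin \<theta>\<bar> * \<bar>B i g\<bar>"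
      unfolding V_def abs_mult[symmetric] by linarith
    also have "\<dots> \<le> 1 * \<bar>A i g\<bar> + 1 * \<bar>B i g\<bar>"
      by (intro add_mono mult_right_mono) auto
    finally show ?thesis by simp
  qed
  \<comment> \<open>A bound on \<open>D\<close> independent of the angle, integrable because
    Gaussian coordinates have a first absolute moment. It yields the joint integrability that Fubini
    asks for.\<close>
  define H where "H g = (\<Sum>i\<in>I. C * (\<bar>A i g\<bar> + \<bar>B i g\<bar>))" for g
  have D_le: "\<bar>D \<theta> g\<bar> \<le> H g" for \<theta> g
    unfolding D_def H_def
  proof (rule order_trans[OF sum_abs], rule sum_mono)
    fix i assume "i \<in> I"
    then show "\<bar>F' i (Z \<theta> g) * V \<theta> i g\<bar> \<le> C * (\<bar>A i g\<bar> + \<bar>B i g\<bar>)"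
      unfolding abs_mult using bd(2)[of i "Z \<theta> g"] V_le[of \<theta> i g] by (intro mult_mono) auto
  qed
  have iH: "integrable ?P H"
    unfolding H_def[abs_def] using iAB by auto
  then have [measurable]: "H \<in> borel_measurable ?P" by auto
  have H_nonneg: "0 \<le> H g" for g
    using D_le[of 0 g] by linarith
  have mD1[measurable]: "D \<theta> \<in> borel_measurable ?P" for \<theta>
    unfolding D_def[abs_def] V_def by measurable
  have iD: "integrable (lborel \<Otimes>\<^sub>M ?P) (\<lambda>(\<theta>, g). D \<theta> g * indicator ?J \<theta>)"
  proof (rule Bochner_Integration.integrable_bound)
    show "integrable (lborel \<Otimes>\<^sub>M ?P) (\<lambda>(\<theta>, g). H g * indicator ?J \<theta>)"
    proof (rule LP.Fubini_integrable)
      have "integrable lborel (\<lambda>\<theta>. (\<integral>g. H g \<partial>?P) * indicator ?J \<theta> :: real)"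
        by (intro integrable_mult_right integrable_real_indicator) auto
      then show "integrable lborel (\<lambda>\<theta>. \<integral>g. norm (case (\<theta>, g) of (\<theta>, g) \<Rightarrow> H g * indicator ?J \<theta>) \<partial>?P)"
        using H_nonneg by (simp add: abs_mult)
    qed (use iH in auto)
    show "AE p in lborel \<Otimes>\<^sub>M ?P. norm (case p of (\<theta>, g) \<Rightarrow> D \<theta> g * indicator ?J \<theta>)
        \<le> norm (case p of (\<theta>, g) \<Rightarrow> H g * indicator ?J \<theta>)"
      using D_le order_trans[OF D_le abs_ge_self] by (auto simp: abs_mult intro!: AE_I2 mult_right_mono)
    show "(\<lambda>(\<theta>, g). D \<theta> g * indicator ?J \<theta>) \<in> borel_measurable (lborel \<Otimes>\<^sub>M ?P)"
      unfolding split_beta' by measurable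
  qed

  \<comment> \<open>The fundamental theorem of calculus is applied for each fixed \<open>g\<close>.
    Expectations enter only afterwards, by exchanging integrals, which replaces differentiation
    under the integral sign.\<close>
  have ftc: "(\<integral>\<theta>. D \<theta> g * indicator ?J \<theta> \<partial>lborel) = F (\<lambda>i. A i g) - F (\<lambda>i. B i g)" for g
  proof -
    have dZ: "((\<lambda>\<theta>. Z \<theta> g i) has_real_derivative V \<theta> i g) (at \<theta>)" for i \<theta>
      unfolding Z_def V_def by (auto intro!: derivative_eq_intros)
    have cF': "isCont (\<lambda>\<theta>. F' i (Z \<theta> g)) \<theta>" if "i \<in> I" for i \<theta>
      by (rule DERIV_isCont[OF dF'[OF that dZ]])
    have "(\<integral>\<theta>. D \<theta> g * indicator ?J \<theta> \<partial>lborel) = F (Z (pi/2) g) - F (Z 0 g)"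
    proof (rule integral_FTC_Icc_real)
      show "((\<lambda>\<theta>. F (Z \<theta> g)) has_real_derivative D \<theta> g) (at \<theta>)" for \<theta>
        unfolding D_def by (rule dF[OF dZ])
      show "isCont (\<lambda>\<theta>. D \<theta> g) \<theta>" for \<theta>
        unfolding D_def V_def using cF' by (intro continuous_intros) auto
    qed simp
    then show ?thesis by (simp add: Z_def)
  qed

  have ED: "0 \<le> (\<integral>g. D \<theta> g \<partial>?P)" if \<theta>: "\<theta> \<in> ?J" for \<theta>
  proof -
    define w where "w i s = sin \<theta> * \<alpha> i s + cos \<theta> * \<beta> i s" for i s
    define v where "v i s = cos \<theta> * \<alpha> i s - sin \<theta> * \<beta> i s" for i s
    have Zw: "Z \<theta> g = (\<lambda>i. \<Sum>s\<in>S. w i s * g s)" for g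
      by (simp add: Z_def A_def B_def w_def sum_distrib_left sum.distrib ring_distribs mult.assoc)
    have Vv: "V \<theta> i g = (\<Sum>s\<in>S. v i s * g s)" for i g
      by (simp add: V_def A_def B_def v_def sum_distrib_left sum_subtractf ring_distribs mult.assoc)
    have iF'': "integrable ?P (\<lambda>g. F'' i j (Z \<theta> g))" if "i \<in> I" "j \<in> I" for i j
      using that bd(3) by (intro P.integrable_const_bound[where B=C]) auto
    \<comment> \<open>Each factor \<open>g s\<close> contributed by \<open>V\<close> is traded for a
      derivative in the coordinate \<open>s\<close>, along which the component \<open>j\<close> of
      \<open>Z \<theta>\<close> has slope \<open>w j s\<close>.\<close>
    have stein: "(\<integral>g. g s * F' i (Z \<theta> g) \<partial>?P) = (\<Sum>j\<in>I. (\<integral>g. F'' i j (Z \<theta> g) \<partial>?P) * w j s)"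
      if i: "i \<in> I" and s: "s \<in> S" for i s
    proof -
      have dZ: "((\<lambda>t. Z \<theta> (g(s := t)) k) has_real_derivative w k s) (at t)" for g t k
      proof -
        have "Z \<theta> (g(s := t)) k = w k s * t + (\<Sum>r\<in>S - {s}. w k r * g r)" for t
          unfolding Zw using s fin by (subst sum.remove[of S s]) (auto intro!: sum.cong)
        then show ?thesis by (auto intro!: derivative_eq_intros)
      qed
      \<comment> \<open>One constant has to bound both \<open>F' i\<close> and its derivative in the
        coordinate \<open>s\<close>, a combination of second derivatives with weights
        \<open>w j s\<close>.\<close>
      define C' where "C' = C + C * (\<Sum>j\<in>I. \<bar>w j s\<bar>)"
      have C: "0 \<le> C" using bd(1)[of undefined] by linarith
      have "(\<integral>g. g s * F' i (Z \<theta> g) \<partial>?P) = (\<integral>g. (\<Sum>j\<in>I. F'' i j (Z \<theta> g) * w j s) \<partial>?P)"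
      proof (rule stein_identity_vec[OF fin(1) s, where C=C'])
        show "(\<lambda>g. F' i (Z \<theta> g)) \<in> borel_measurable ?P"
          using mF'1[OF i] .
        show "(\<lambda>g. \<Sum>j\<in>I. F'' i j (Z \<theta> g) * w j s) \<in> borel_measurable ?P"
          using i by measurable
        show "((\<lambda>t. F' i (Z \<theta> (g(s := t)))) has_real_derivative
            (\<Sum>j\<in>I. F'' i j (Z \<theta> (g(s := t))) * w j s)) (at t)" for g t
          by (rule dF'[OF i dZ])
        have "isCont (\<lambda>t. F'' i j (Z \<theta> (g(s := t)))) t" if "j \<in> I" for g t j
          using cF''[where c="\<lambda>t. Z \<theta> (g(s := t))" and t=t, OF i that] DERIV_isCont[OF dZ] by blast
        then show "isCont (\<lambda>t. \<Sum>j\<in>I. F'' i j (Z \<theta> (g(s := t))) * w j s) t" for g t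
          by (intro continuous_intros)
        have "0 \<le> C * (\<Sum>j\<in>I. \<bar>w j s\<bar>)" using C by (simp add: sum_nonneg)
        then show "\<bar>F' i (Z \<theta> g)\<bar> \<le> C'" for g
          using bd(2)[OF i, of "Z \<theta> g"] unfolding C'_def by linarith
        have "\<bar>\<Sum>j\<in>I. F'' i j (Z \<theta> g) * w j s\<bar> \<le> (\<Sum>j\<in>I. C * \<bar>w j s\<bar>)" for g
          using bd(3)[OF i] by (intro order_trans[OF sum_abs] sum_mono) (auto simp: abs_mult intro!: mult_right_mono)
        then show "\<bar>\<Sum>j\<in>I. F'' i j (Z \<theta> g) * w j s\<bar> \<le> C'" for g
          using C unfolding C'_def sum_distrib_left[symmetric] by (meson add_increasing order_trans)
      qed
      also have "\<dots> = (\<Sum>j\<in>I. (\<integral>g. F'' i j (Z \<theta> g) \<partial>?P) * w j s)"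
        using iF'' i by (subst Bochner_Integration.integral_sum) auto
      finally show ?thesis .
    qed
    have iprod: "integrable ?P (\<lambda>g. v i s * (g s * F' i (Z \<theta> g)))" if "i \<in> I" "s \<in> S" for i s
    proof (rule integrable_mult_right, rule Bochner_Integration.integrable_bound)
      show "integrable ?P (\<lambda>g. C * \<bar>g s\<bar>)" using igs that by auto
      have "\<bar>g s\<bar> * \<bar>F' i (Z \<theta> g)\<bar> \<le> \<bar>g s\<bar> * \<bar>C\<bar>" for g
        using bd(2)[OF that(1), of "Z \<theta> g"] by (intro mult_left_mono) auto
      then show "AE g in ?P. norm (g s * F' i (Z \<theta> g)) \<le> norm (C * \<bar>g s\<bar>)"
        by (auto simp: abs_mult mult.commute)
      show "(\<lambda>g. g s * F' i (Z \<theta> g)) \<in> borel_measurable ?P"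
        using mF'1 comp that by (intro borel_measurable_times) auto
    qed
    \<comment> \<open>Here \<open>v\<close> is the derivative of \<open>w\<close> in the angle. The
      terms carrying squares of sine and cosine are cross covariances of the two processes and
      vanish by \<open>orth\<close>, the second one with the indices exchanged.\<close>
    have vw: "(\<Sum>s\<in>S. v i s * w j s) = sin \<theta> * cos \<theta> *
        ((\<Sum>s\<in>S. \<alpha> i s * \<alpha> j s) - (\<Sum>s\<in>S. \<beta> i s * \<beta> j s))" if "i \<in> I" "j \<in> I" for i j
    proof -
      have "(\<Sum>s\<in>S. v i s * w j s) =
          (\<Sum>s\<in>S. sin \<theta> * cos \<theta> * (\<alpha> i s * \<alpha> j s) - sin \<theta> * cos \<theta> * (\<beta> i s * \<beta> j s)
            + (cos \<theta>)\<^sup>2 * (\<alpha> i s * \<beta> j s) - (sin \<theta>)\<^sup>2 * (\<alpha> j s * \<beta> i s))"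
        unfolding v_def w_def by (intro sum.cong refl) (simp add: algebra_simps power2_eq_square)
      then show ?thesis
        unfolding sum.distrib sum_subtractf sum_distrib_left[symmetric] orth[OF that] orth[OF that(2,1)]
        by (simp add: right_diff_distrib)
    qed
    have "(\<integral>g. D \<theta> g \<partial>?P) = (\<integral>g. (\<Sum>i\<in>I. \<Sum>s\<in>S. v i s * (g s * F' i (Z \<theta> g))) \<partial>?P)"
      unfolding D_def Vv by (simp add: sum_distrib_left mult_ac)
    also have "\<dots> = (\<Sum>i\<in>I. \<Sum>s\<in>S. v i s * (\<Sum>j\<in>I. (\<integral>g. F'' i j (Z \<theta> g) \<partial>?P) * w j s))"
      using iprod stein by (simp add: Bochner_Integration.integral_sum)
    also have "\<dots> = (\<Sum>i\<in>I. \<Sum>j\<in>I. (\<integral>g. F'' i j (Z \<theta> g) \<partial>?P) * (\<Sum>s\<in>S. v i s * w j s))"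
      unfolding sum_distrib_left by (subst (2) sum.swap) (intro sum.cong refl mult.left_commute)
    also have "\<dots> = (\<Sum>i\<in>I. \<Sum>j\<in>I. sin \<theta> * cos \<theta> * (\<integral>g. F'' i j (Z \<theta> g) *
        ((\<Sum>s\<in>S. \<alpha> i s * \<alpha> j s) - (\<Sum>s\<in>S. \<beta> i s * \<beta> j s)) \<partial>?P))"
      using vw by (simp add: mult_ac)
    also have "\<dots> \<ge> 0"
    \<comment> \<open>On the quarter turn both sine and cosine are nonnegative, so the sign of each
      summand is that given by \<open>pos\<close>.\<close>
    proof (intro sum_nonneg mult_nonneg_nonneg)
      show "0 \<le> sin \<theta>" "0 \<le> cos \<theta>"
        using \<theta> by (auto intro: sin_ge_zero cos_ge_zero)
    qed (rule integral_nonneg_AE, rule AE_I2, rule pos)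
    finally show ?thesis .
  qed

  have "(\<integral>g. F (\<lambda>i. A i g) - F (\<lambda>i. B i g) \<partial>?P) = (\<integral>\<theta>. (\<integral>g. D \<theta> g * indicator ?J \<theta> \<partial>?P) \<partial>lborel)"
    using LP.Fubini_integral[OF iD] by (simp add: ftc)
  also have "\<dots> \<ge> 0"
  proof (rule integral_nonneg_AE, rule AE_I2)
    show "0 \<le> (\<integral>g. D \<theta> g * indicator ?J \<theta> \<partial>?P)" for \<theta>
      using ED by (cases "\<theta> \<in> ?J") simp_all
  qed
  finally have "0 \<le> (\<integral>g. F (\<lambda>i. A i g) - F (\<lambda>i. B i g) \<partial>?P)" .
  moreover have "integrable ?P (\<lambda>g. F (\<lambda>i. A i g))" "integrable ?P (\<lambda>g. F (\<lambda>i. B i g))"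
    using mF bd(1) by (auto intro!: P.integrable_const_bound[where B=C])
  ultimately show ?thesis
    by (simp add: A_def B_def)
qed

subsection \<open>A smooth approximation of the max-min indicator\<close>

locale max_min_smoothing =
  fixes X :: "'a set" and Y :: "'b set" and K \<beta> \<tau> :: real
  assumes finite_X: "finite X" and finite_Y: "finite Y"
    and K_nonneg: "0 \<le> K" and \<beta>_nonneg: "0 \<le> \<beta>"
begin

definition e :: "'a \<times> 'b \<Rightarrow> ('a \<times> 'b \<Rightarrow> real) \<Rightarrow> real" where
  "e i z = exp (- \<beta> * (z i - \<tau>))"

text \<open>A soft indicator that row \<open>a\<close> has no entry below \<open>\<tau>\<close>: for
  large \<open>\<beta>\<close>, one entry below \<open>\<tau>\<close> makes some \<open>e\<close>
  huge and \<open>R a\<close> nearly 0. With \<open>K\<close> large, \<open>F\<close> is then close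
  to 1 only if every \<open>R a\<close> is tiny, that is, if each row dips below
  \<open>\<tau>\<close>.\<close>

definition R :: "'a \<Rightarrow> ('a \<times> 'b \<Rightarrow> real) \<Rightarrow> real" where
  "R a z = exp (- (\<Sum>b\<in>Y. e (a, b) z))"

definition F :: "('a \<times> 'b \<Rightarrow> real) \<Rightarrow> real" where
  "F z = exp (- K * (\<Sum>a\<in>X. R a z))"

definition F' :: "'a \<times> 'b \<Rightarrow> ('a \<times> 'b \<Rightarrow> real) \<Rightarrow> real" where
  "F' i z = - K * \<beta> * F z * R (fst i) z * e i z"

text \<open>The second partial derivative, obtained by the product rule from
  \<open>F * R * e\<close>. The first term differentiates \<open>F\<close>, the second
  \<open>R\<close> (which sees only its own row), the third \<open>e\<close> (which sees only its
  own entry).\<close>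

definition F'' :: "'a \<times> 'b \<Rightarrow> 'a \<times> 'b \<Rightarrow> ('a \<times> 'b \<Rightarrow> real) \<Rightarrow> real" where
  "F'' i j z = - K * \<beta> * (F' j z * (R (fst i) z * e i z)
     + (if fst i = fst j then F z * (\<beta> * (R (fst i) z * e i z * e j z)) else 0)
     - (if i = j then F z * (\<beta> * (R (fst i) z * e i z)) else 0))"

section \<open>Derivatives of the smoothing\<close>

lemma has_derivative_e:
  assumes "((\<lambda>t. c t i) has_real_derivative c') (at u)"
  shows "((\<lambda>t. e i (c t)) has_real_derivative - \<beta> * e i (c u) * c') (at u)"
  unfolding e_def by (rule derivative_eq_intros assms refl | simp)+

lemma has_derivative_R:
  assumes "\<And>b. b \<in> Y \<Longrightarrow> ((\<lambda>t. c t (a, b)) has_real_derivative c' (a, b)) (at u)"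
  shows "((\<lambda>t. R a (c t)) has_real_derivative
    (\<Sum>b\<in>Y. \<beta> * R a (c u) * e (a, b) (c u) * c' (a, b))) (at u)"
proof -
  have "((\<lambda>t. R a (c t)) has_real_derivative
      R a (c u) * - (\<Sum>b\<in>Y. - \<beta> * e (a, b) (c u) * c' (a, b))) (at u)"
    unfolding R_def
    by (intro DERIV_fun_exp DERIV_minus DERIV_sum has_derivative_e assms)
  then show ?thesis
    by (simp add: sum_negf sum_distrib_left mult_ac)
qed

lemma has_derivative_F:
  assumes c: "\<And>i. i \<in> X \<times> Y \<Longrightarrow> ((\<lambda>t. c t i) has_real_derivative c' i) (at u)"
  shows "((\<lambda>t. F (c t)) has_real_derivative (\<Sum>i\<in>X \<times> Y. F' i (c u) * c' i)) (at u)"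
proof -
  have "((\<lambda>t. F (c t)) has_real_derivative
      F (c u) * (- K * (\<Sum>a\<in>X. \<Sum>b\<in>Y. \<beta> * R a (c u) * e (a, b) (c u) * c' (a, b)))) (at u)"
    unfolding F_def
    by (intro DERIV_fun_exp DERIV_cmult DERIV_sum has_derivative_R c) auto
  also have "F (c u) * (- K * (\<Sum>a\<in>X. \<Sum>b\<in>Y. \<beta> * R a (c u) * e (a, b) (c u) * c' (a, b)))
      = (\<Sum>i\<in>X \<times> Y. F' i (c u) * c' i)"
    unfolding F'_def sum.cartesian_product sum_distrib_left
    by (intro sum.cong refl) (auto simp: mult_ac)
  finally show ?thesis .
qed

lemma has_derivative_F':
  assumes i: "i \<in> X \<times> Y"
    and c: "\<And>j. j \<in> X \<times> Y \<Longrightarrow> ((\<lambda>t. c t j) has_real_derivative c' j) (at u)"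
  shows "((\<lambda>t. F' i (c t)) has_real_derivative (\<Sum>j\<in>X \<times> Y. F'' i j (c u) * c' j)) (at u)"
proof -
  obtain a b where ab: "i = (a, b)" "a \<in> X" "b \<in> Y" using i by auto
  let ?r = "R a (c u)" and ?e = "e i (c u)" and ?F = "F (c u)"
  have d: "((\<lambda>t. - K * \<beta> * (F (c t) * (R a (c t) * e i (c t)))) has_real_derivative
      - K * \<beta> * ((\<Sum>j\<in>X \<times> Y. F' j (c u) * c' j) * (?r * ?e)
        + ((\<Sum>b\<in>Y. \<beta> * ?r * e (a, b) (c u) * c' (a, b)) * ?e
            + (- \<beta> * ?e * c' i) * ?r) * ?F)) (at u)"
    using ab
    by (intro DERIV_cmult DERIV_mult has_derivative_F has_derivative_R has_derivative_e c) auto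
  \<comment> \<open>The row sum from \<open>R\<close> and the single term from \<open>e\<close> are
    spread over all of \<open>X \<times> Y\<close> with conditionals, so that the three
    contributions can be added index by index and matched with \<open>F''\<close>.\<close>
  have s1: "(\<Sum>b\<in>Y. \<beta> * ?r * e (a, b) (c u) * c' (a, b))
      = (\<Sum>j\<in>X \<times> Y. if fst i = fst j then \<beta> * ?r * e j (c u) * c' j else 0)"
  proof -
    have "(\<Sum>j\<in>X \<times> Y. if fst i = fst j then \<beta> * ?r * e j (c u) * c' j else 0)
        = (\<Sum>x\<in>X. \<Sum>y\<in>Y. if a = x then \<beta> * ?r * e (x, y) (c u) * c' (x, y) else 0)"
      unfolding sum.cartesian_product ab by (intro sum.cong) auto
    also have "\<dots> = (\<Sum>x\<in>X. if a = x then \<Sum>y\<in>Y. \<beta> * ?r * e (x, y) (c u) * c' (x, y) else 0)"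
      by (intro sum.cong) auto
    finally show ?thesis
      using ab finite_X by simp
  qed
  have s2: "- \<beta> * ?e * c' i = (\<Sum>j\<in>X \<times> Y. if i = j then - \<beta> * ?e * c' j else 0)"
    using i finite_X finite_Y by simp
  have "((\<lambda>t. - K * \<beta> * (F (c t) * (R a (c t) * e i (c t)))) has_real_derivative
      - K * \<beta> * ((\<Sum>j\<in>X \<times> Y. F' j (c u) * c' j) * (?r * ?e)
        + ((\<Sum>j\<in>X \<times> Y. if fst i = fst j then \<beta> * ?r * e j (c u) * c' j else 0) * ?e
            + (\<Sum>j\<in>X \<times> Y. if i = j then - \<beta> * ?e * c' j else 0) * ?r) * ?F)) (at u)"
    using d unfolding s1 s2 .
  also have "- K * \<beta> * ((\<Sum>j\<in>X \<times> Y. F' j (c u) * c' j) * (?r * ?e)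
        + ((\<Sum>j\<in>X \<times> Y. if fst i = fst j then \<beta> * ?r * e j (c u) * c' j else 0) * ?e
            + (\<Sum>j\<in>X \<times> Y. if i = j then - \<beta> * ?e * c' j else 0) * ?r) * ?F)
      = (\<Sum>j\<in>X \<times> Y. F'' i j (c u) * c' j)"
    unfolding sum_distrib_left sum_distrib_right sum.distrib[symmetric]
    by (intro sum.cong refl) (auto simp: F''_def ab algebra_simps)
  finally show ?thesis
    by (simp add: F'_def ab mult_ac)
qed

section \<open>Measurability and continuity of the smoothing\<close>

lemma measurable_e: "e i \<in> borel_measurable (Pi\<^sub>M UNIV (\<lambda>_. borel))"
  unfolding e_def[abs_def] by measurable

lemma measurable_R: "R a \<in> borel_measurable (Pi\<^sub>M UNIV (\<lambda>_. borel))"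
  unfolding R_def[abs_def] using measurable_e by measurable

lemma measurable_F: "F \<in> borel_measurable (Pi\<^sub>M UNIV (\<lambda>_. borel))"
  unfolding F_def[abs_def] using measurable_R by measurable

lemma measurable_F': "F' i \<in> borel_measurable (Pi\<^sub>M UNIV (\<lambda>_. borel))"
  unfolding F'_def[abs_def] using measurable_e measurable_R measurable_F by measurable

lemma measurable_F'': "F'' i j \<in> borel_measurable (Pi\<^sub>M UNIV (\<lambda>_. borel))"
  unfolding F''_def[abs_def]
  using measurable_e measurable_R measurable_F measurable_F' by measurable

lemma isCont_F'':
  assumes "i \<in> X \<times> Y" "j \<in> X \<times> Y"
    and c: "\<And>k. k \<in> X \<times> Y \<Longrightarrow> isCont (\<lambda>t. c t k) u"
  shows "isCont (\<lambda>t. F'' i j (c t)) u"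
proof -
  have e: "isCont (\<lambda>t. e k (c t)) u" if "k \<in> X \<times> Y" for k
    unfolding e_def using c[OF that] by (intro continuous_intros)
  have R: "isCont (\<lambda>t. R a (c t)) u" if "a \<in> X" for a
    unfolding R_def using e that by (intro continuous_intros) auto
  have F: "isCont (\<lambda>t. F (c t)) u"
    unfolding F_def using R by (intro continuous_intros) auto
  show ?thesis
    using assms(1,2)
    by (cases "fst i = fst j"; cases "i = j"; simp add: F''_def F'_def)
      (intro continuous_intros e R F; auto)+
qed

section \<open>Uniform bounds and signs of the derivatives\<close>

lemma F_bounds: "0 < F z" "F z \<le> 1"
  unfolding F_def using K_nonneg by (auto intro!: mult_nonneg_nonneg sum_nonneg simp: R_def)

lemma e_nonneg: "0 \<le> e i z"
  by (simp add: e_def)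

lemma R_nonneg: "0 \<le> R a z"
  by (simp add: R_def)

lemma e_le_sum: "b \<in> Y \<Longrightarrow> e (a, b) z \<le> (\<Sum>b\<in>Y. e (a, b) z)"
  using finite_Y e_nonneg by (intro member_le_sum) auto

text \<open>With \<open>q\<close> the sum of the row's \<open>e\<close> values,
  \<open>e i z \<le> q \<le> exp q\<close>, while \<open>R\<close> is \<open>exp (- q)\<close>. The
  unbounded factor \<open>e\<close> is thus absorbed by \<open>R\<close>.\<close>

lemma R_e_le: 
  assumes "i \<in> X \<times> Y"
  shows "R (fst i) z * e i z \<le> 1"
proof -
  obtain a b where ab: "i = (a, b)" "b \<in> Y" using assms by auto
  have "e i z \<le> exp (\<Sum>b\<in>Y. e (a, b) z)"
    using e_le_sum[OF ab(2), of a z] exp_ge_add_one_self[of "\<Sum>b\<in>Y. e (a, b) z"]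
    unfolding ab(1) by linarith
  then show ?thesis
    by (simp add: R_def ab exp_minus field_simps)
qed

text \<open>Both entries share the row sum \<open>q\<close>, so the product of the two
  \<open>e\<close> values is at most \<open>q * q\<close>, and \<open>q * q \<le> 2 * exp q\<close>
  by the quadratic Taylor bound.\<close>

lemma R_e_e_le:
  assumes "i \<in> X \<times> Y" "j \<in> X \<times> Y" "fst i = fst j"
  shows "R (fst i) z * e i z * e j z \<le> 2"
proof -
  obtain a b b' where ab: "i = (a, b)" "b \<in> Y" "j = (a, b')" "b' \<in> Y" using assms by auto
  let ?q = "\<Sum>b\<in>Y. e (a, b) z"
  have q: "0 \<le> ?q" by (intro sum_nonneg e_nonneg)
  have "e i z * e j z \<le> ?q * ?q"
    using e_le_sum ab e_nonneg q by (intro mult_mono) auto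
  also have "\<dots> \<le> 2 * exp ?q"
    using exp_lower_Taylor_quadratic[OF q] q by (simp add: power2_eq_square)
  finally show ?thesis
    by (simp add: R_def ab exp_minus field_simps)
qed

lemma abs_F'_le:
  assumes "i \<in> X \<times> Y"
  shows "\<bar>F' i z\<bar> \<le> K * \<beta>"
proof -
  have "F z * (R (fst i) z * e i z) \<le> 1 * 1"
    using F_bounds[of z] R_e_le[OF assms] e_nonneg R_nonneg by (intro mult_mono) auto
  then have "K * \<beta> * (F z * (R (fst i) z * e i z)) \<le> K * \<beta> * 1"
    using K_nonneg \<beta>_nonneg by (intro mult_left_mono) auto
  moreover have "\<bar>F' i z\<bar> = K * \<beta> * (F z * (R (fst i) z * e i z))"
    using F_bounds(1)[of z] K_nonneg \<beta>_nonneg e_nonneg[of i z] R_nonneg[of "fst i" z]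
    by (simp add: F'_def abs_mult)
  ultimately show ?thesis by simp
qed

text \<open>The three summands \<open>K * \<beta>\<close>, \<open>2 * \<beta>\<close> and
  \<open>\<beta>\<close> bound, in this order, the terms of \<open>F''\<close> that come from
  differentiating \<open>F\<close>, \<open>R\<close> and \<open>e\<close>.\<close>

lemma abs_F''_le:
  assumes "i \<in> X \<times> Y" "j \<in> X \<times> Y"
  shows "\<bar>F'' i j z\<bar> \<le> K * \<beta> * (K * \<beta> + 2 * \<beta> + \<beta>)"
proof -
  let ?re = "R (fst i) z * e i z"
  have re: "0 \<le> ?re" "?re \<le> 1"
    using R_e_le[OF assms(1)] e_nonneg R_nonneg by auto
  have F: "0 \<le> F z" "F z \<le> 1" using F_bounds[of z] by auto
  have 1: "\<bar>F' j z * ?re\<bar> \<le> K * \<beta>"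
  proof -
    have "\<bar>F' j z\<bar> * ?re \<le> K * \<beta> * 1"
      using abs_F'_le[OF assms(2), of z] re K_nonneg \<beta>_nonneg by (intro mult_mono) auto
    then show ?thesis using e_nonneg R_nonneg by (simp add: abs_mult)
  qed
  have 2: "\<bar>if fst i = fst j then F z * (\<beta> * (?re * e j z)) else 0\<bar> \<le> 2 * \<beta>"
  proof (cases "fst i = fst j")
    case True
    have "F z * (\<beta> * (?re * e j z)) \<le> 1 * (\<beta> * 2)"
      using R_e_e_le[OF assms True] F e_nonneg R_nonneg \<beta>_nonneg by (intro mult_mono mult_nonneg_nonneg) auto
    moreover have "0 \<le> F z * (\<beta> * (?re * e j z))"
      using F e_nonneg R_nonneg \<beta>_nonneg by simp
    ultimately show ?thesis using True by simp
  qed (use \<beta>_nonneg in simp)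
  have 3: "\<bar>if i = j then F z * (\<beta> * ?re) else 0\<bar> \<le> \<beta>"
  proof -
    have "F z * (\<beta> * ?re) \<le> 1 * (\<beta> * 1)"
      using F re(2) e_nonneg R_nonneg \<beta>_nonneg by (intro mult_mono) auto
    moreover have "0 \<le> F z * (\<beta> * ?re)"
      using F e_nonneg R_nonneg \<beta>_nonneg by simp
    ultimately show ?thesis using \<beta>_nonneg by (cases "i = j") simp_all
  qed
  have "\<bar>F' j z * ?re
      + (if fst i = fst j then F z * (\<beta> * (?re * e j z)) else 0)
      - (if i = j then F z * (\<beta> * ?re) else 0)\<bar> \<le> K * \<beta> + 2 * \<beta> + \<beta>"
    using 1 2 3 by linarith
  then have "\<bar>- K * \<beta>\<bar> * \<bar>F' j z * ?re
      + (if fst i = fst j then F z * (\<beta> * (?re * e j z)) else 0)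
      - (if i = j then F z * (\<beta> * ?re) else 0)\<bar> \<le> \<bar>- K * \<beta>\<bar> * (K * \<beta> + 2 * \<beta> + \<beta>)"
    by (intro mult_left_mono) auto
  then show ?thesis
    unfolding F''_def abs_mult using K_nonneg \<beta>_nonneg by simp
qed

text \<open>Across rows only the term from differentiating \<open>F\<close> survives, and the two
  factors \<open>- K * \<beta>\<close> multiply to a square.\<close>

lemma F''_nonneg:
  assumes "fst i \<noteq> fst j"
  shows "0 \<le> F'' i j z"
proof -
  have "F'' i j z = (K * \<beta>)\<^sup>2 * F z * (R (fst i) z * e i z) * (R (fst j) z * e j z)"
    using assms by (auto simp: F''_def F'_def power2_eq_square)
  then show ?thesis
    using F_bounds[of z] e_nonneg R_nonneg by simp
qed

text \<open>The sign condition of the interpolation holds for two different reasons: within a row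
  the covariance difference is zero, and across rows both it and \<open>F''\<close> are nonnegative.
  The constant \<open>C\<close> adds the bounds for \<open>F\<close>, \<open>F'\<close> and
  \<open>F''\<close>, so that it serves all three.\<close>

lemma expectation_F_le:
  fixes \<alpha> \<gamma> :: "'a \<times> 'b \<Rightarrow> 's \<Rightarrow> real"
  assumes "finite S"
    and orth: "\<And>i j. i \<in> X \<times> Y \<Longrightarrow> j \<in> X \<times> Y \<Longrightarrow> (\<Sum>s\<in>S. \<alpha> i s * \<gamma> j s) = 0"
    and row: "\<And>i j. i \<in> X \<times> Y \<Longrightarrow> j \<in> X \<times> Y \<Longrightarrow> fst i = fst j \<Longrightarrow>
      (\<Sum>s\<in>S. \<alpha> i s * \<alpha> j s) = (\<Sum>s\<in>S. \<gamma> i s * \<gamma> j s)"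
    and cross: "\<And>i j. i \<in> X \<times> Y \<Longrightarrow> j \<in> X \<times> Y \<Longrightarrow> fst i \<noteq> fst j \<Longrightarrow>
      (\<Sum>s\<in>S. \<gamma> i s * \<gamma> j s) \<le> (\<Sum>s\<in>S. \<alpha> i s * \<alpha> j s)"
  shows "(\<integral>g. F (\<lambda>i. \<Sum>s\<in>S. \<gamma> i s * g s) \<partial>std_normal_vec S)
      \<le> (\<integral>g. F (\<lambda>i. \<Sum>s\<in>S. \<alpha> i s * g s) \<partial>std_normal_vec S)"
proof (rule gaussian_interpolation[where I="X \<times> Y" and F'=F' and F''=F''
      and C="1 + K * \<beta> + K * \<beta> * (K * \<beta> + 2 * \<beta> + \<beta>)"])
  have b: "0 \<le> K * \<beta>" "0 \<le> K * \<beta> * (K * \<beta> + 2 * \<beta> + \<beta>)"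
    using K_nonneg \<beta>_nonneg by simp_all
  show "\<bar>F z\<bar> \<le> 1 + K * \<beta> + K * \<beta> * (K * \<beta> + 2 * \<beta> + \<beta>)" for z
    using F_bounds[of z] b by linarith
  show "\<bar>F' i z\<bar> \<le> 1 + K * \<beta> + K * \<beta> * (K * \<beta> + 2 * \<beta> + \<beta>)" if "i \<in> X \<times> Y" for i z
    using abs_F'_le[OF that, of z] b by linarith
  show "\<bar>F'' i j z\<bar> \<le> 1 + K * \<beta> + K * \<beta> * (K * \<beta> + 2 * \<beta> + \<beta>)"
    if "i \<in> X \<times> Y" "j \<in> X \<times> Y" for i j z
    using abs_F''_le[OF that, of z] b by linarith
  show "0 \<le> F'' i j z * ((\<Sum>s\<in>S. \<alpha> i s * \<alpha> j s) - (\<Sum>s\<in>S. \<gamma> i s * \<gamma> j s))"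
    if "i \<in> X \<times> Y" "j \<in> X \<times> Y" for i j z
  proof (cases "fst i = fst j")
    case True
    then show ?thesis using row[OF that] by simp
  next
    case False
    then show ?thesis using cross[OF that False] F''_nonneg[OF False] by simp
  qed
  show "((\<lambda>t. F (c t)) has_real_derivative (\<Sum>i\<in>X \<times> Y. F' i (c u) * c' i)) (at u)"
    if "\<And>i. i \<in> X \<times> Y \<Longrightarrow> ((\<lambda>t. c t i) has_real_derivative c' i) (at u)" for c c' u
    using that by (rule has_derivative_F)
  show "((\<lambda>t. F' i (c t)) has_real_derivative (\<Sum>j\<in>X \<times> Y. F'' i j (c u) * c' j)) (at u)"
    if "i \<in> X \<times> Y" "\<And>j. j \<in> X \<times> Y \<Longrightarrow> ((\<lambda>t. c t j) has_real_derivative c' j) (at u)" for i c c' u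
    using that by (rule has_derivative_F')
  show "isCont (\<lambda>t. F'' i j (c t)) u"
    if "i \<in> X \<times> Y" "j \<in> X \<times> Y" "\<And>k. k \<in> X \<times> Y \<Longrightarrow> isCont (\<lambda>t. c t k) u"
    for i j u and c :: "real \<Rightarrow> 'a \<times> 'b \<Rightarrow> real"
    using that by (rule isCont_F'')
qed (rule assms(1) orth measurable_F measurable_F' measurable_F'' finite_cartesian_product
    finite_X finite_Y | assumption)+

end

section \<open>The limit of the smoothing\<close>

lemma max_min_less_iff:
  fixes z :: "'a \<times> 'b \<Rightarrow> real"
  assumes "finite X" "finite Y" "X \<noteq> {}" "Y \<noteq> {}"
  shows "(MAX a\<in>X. MIN b\<in>Y. z (a, b)) < t \<longleftrightarrow> (\<forall>a\<in>X. \<exists>b\<in>Y. z (a, b) < t)"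
  using assms by (simp add: Min_less_iff)

text \<open>If every row has an entry at distance \<open>\<delta> > 0\<close> below
  \<open>\<tau>\<close>, the double exponential \<open>exp (- exp (n * \<delta>))\<close> beats the
  factor \<open>K = n\<close>. Otherwise some row lies entirely at or above \<open>\<tau>\<close>;
  its \<open>e\<close> values are at most 1, so its \<open>R\<close> stays above
  \<open>exp (- card Y)\<close> and \<open>K = n\<close> drives \<open>F\<close> to 0. A tie with
  \<open>\<tau>\<close> belongs to the second case, in accordance with the strict
  inequality.\<close>

lemma max_min_smoothing_tendsto:
  fixes z :: "'a \<times> 'b \<Rightarrow> real"
  assumes fin: "finite X" "finite Y" "X \<noteq> {}" "Y \<noteq> {}"
  shows "(\<lambda>n. max_min_smoothing.F X Y (real n) (real n) \<tau> z)
    \<longlonglongrightarrow> (if (MAX a\<in>X. MIN b\<in>Y. z (a, b)) < \<tau> then 1 else 0)"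
proof -
  \<comment> \<open>Interpreting for a variable \<open>n\<close> gives \<open>e\<close>,
    \<open>R\<close> and \<open>F\<close> the argument \<open>n\<close> in front, so
    \<open>F n\<close> is the smoothing with \<open>K = \<beta> = n\<close>.\<close>
  interpret max_min_smoothing X Y "real n" "real n" \<tau> for n
    by unfold_locales (use fin in auto)
  show ?thesis
  proof (cases "(MAX a\<in>X. MIN b\<in>Y. z (a, b)) < \<tau>")
    case True
    have "(\<lambda>n. real n * R n a z) \<longlonglongrightarrow> 0" if "a \<in> X" for a
    proof -
      have "\<exists>b\<in>Y. z (a, b) < \<tau>"
        using iffD1[OF max_min_less_iff[OF fin] True] that by (rule bspec)
      then obtain b where b: "b \<in> Y" "z (a, b) < \<tau>" ..
      define \<delta> where "\<delta> = \<tau> - z (a, b)"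
      have \<delta>: "\<delta> > 0" using b by (simp add: \<delta>_def)
      have "R n a z \<le> exp (- exp (real n * \<delta>))" for n
        using e_le_sum[OF b(1), of n a z] by (simp add: R_def e_def \<delta>_def algebra_simps)
      then have le: "real n * R n a z \<le> real n * exp (- exp (real n * \<delta>))" for n
        by (intro mult_left_mono) auto
      show ?thesis
      proof (rule tendsto_sandwich[OF _ _ tendsto_const])
        show "(\<lambda>n. real n * exp (- exp (real n * \<delta>))) \<longlonglongrightarrow> 0"
          using \<delta> by real_asymp
      qed (use le R_nonneg in auto)
    qed
    then have "(\<lambda>n. exp (- (\<Sum>a\<in>X. real n * R n a z))) \<longlonglongrightarrow> exp (- (\<Sum>a\<in>X. 0))"
      by (intro tendsto_intros)
    then show ?thesis
      using True by (simp add: F_def sum_distrib_left sum_negf)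
  next
    case False
    then have "\<exists>a\<in>X. \<forall>b\<in>Y. \<tau> \<le> z (a, b)"
      by (simp add: max_min_less_iff[OF fin] not_less)
    then obtain a where a: "a \<in> X" "\<And>b. b \<in> Y \<Longrightarrow> \<tau> \<le> z (a, b)" by metis
    have R_ge: "exp (- real (card Y)) \<le> R n a z" for n
    proof -
      have "(\<Sum>b\<in>Y. e n (a, b) z) \<le> (\<Sum>b\<in>Y. 1)"
        using a(2) by (intro sum_mono) (simp add: e_def)
      then show ?thesis by (simp add: R_def)
    qed
    have le: "F n z \<le> exp (- real n * exp (- real (card Y)))" for n
    proof -
      have "exp (- real (card Y)) \<le> (\<Sum>a\<in>X. R n a z)"
        by (rule order_trans[OF R_ge[of n] member_le_sum[OF a(1), of "\<lambda>a. R n a z"]])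
          (simp_all add: R_nonneg fin)
      then show ?thesis by (simp add: F_def mult_left_mono)
    qed
    have "(\<lambda>n. F n z) \<longlonglongrightarrow> 0"
    proof (rule tendsto_sandwich[OF _ _ tendsto_const])
      show "(\<lambda>n. exp (- real n * exp (- real (card Y)))) \<longlonglongrightarrow> 0"
        by real_asymp
    qed (simp_all only: le less_imp_le[OF F_bounds(1)] eventually_True)
    then show ?thesis using False by simp
  qed
qed

lemma borel_measurable_max_min:
  fixes z :: "'a \<times> 'b \<Rightarrow> 'w \<Rightarrow> real"
  assumes "finite X" "finite Y" "\<And>i. z i \<in> borel_measurable M"
  shows "(\<lambda>w. MAX a\<in>X. MIN b\<in>Y. z (a, b) w) \<in> borel_measurable M"
  using assms by (intro borel_measurable_Max borel_measurable_Min)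

lemma linear_borel_measurable_std_normal_vec:
  "(\<lambda>g. \<Sum>s\<in>S. \<alpha> s * g s) \<in> borel_measurable (std_normal_vec S)"
  by (intro borel_measurable_sum borel_measurable_times borel_measurable_const
      measurable_std_normal_vec_component)

subsection \<open>Gordon's comparison inequality\<close>

text \<open>The comparison of smoothed indicators passes to the limit by dominated convergence with
  bound 1. The pointwise limit is exactly the strict indicator, so every threshold
  \<open>\<tau>\<close> is covered, atoms included.\<close>

lemma gordon_cdf_le:
  fixes \<alpha> \<gamma> :: "'a \<times> 'b \<Rightarrow> 's \<Rightarrow> real"
  assumes "finite S" and fin: "finite X" "finite Y" "X \<noteq> {}" "Y \<noteq> {}"
    and orth: "\<And>i j. i \<in> X \<times> Y \<Longrightarrow> j \<in> X \<times> Y \<Longrightarrow> (\<Sum>s\<in>S. \<alpha> i s * \<gamma> j s) = 0"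
    and row: "\<And>i j. i \<in> X \<times> Y \<Longrightarrow> j \<in> X \<times> Y \<Longrightarrow> fst i = fst j \<Longrightarrow>
      (\<Sum>s\<in>S. \<alpha> i s * \<alpha> j s) = (\<Sum>s\<in>S. \<gamma> i s * \<gamma> j s)"
    and cross: "\<And>i j. i \<in> X \<times> Y \<Longrightarrow> j \<in> X \<times> Y \<Longrightarrow> fst i \<noteq> fst j \<Longrightarrow>
      (\<Sum>s\<in>S. \<gamma> i s * \<gamma> j s) \<le> (\<Sum>s\<in>S. \<alpha> i s * \<alpha> j s)"
  defines "mm \<equiv> \<lambda>\<kappa> g. MAX a\<in>X. MIN b\<in>Y. \<Sum>s\<in>S. \<kappa> (a, b) s * g s"
  shows "measure (std_normal_vec S) {g \<in> space (std_normal_vec S). mm \<gamma> g < \<tau>}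
      \<le> measure (std_normal_vec S) {g \<in> space (std_normal_vec S). mm \<alpha> g < \<tau>}"
proof -
  let ?P = "std_normal_vec S"
  interpret P: prob_space ?P by (rule prob_space_std_normal_vec)
  interpret max_min_smoothing X Y "real n" "real n" \<tau> for n
    by unfold_locales (use fin in auto)
  let ?z = "\<lambda>\<kappa> g i. \<Sum>s\<in>S. \<kappa> i s * g s"
  have [measurable]: "mm \<kappa> \<in> borel_measurable ?P" for \<kappa>
    unfolding mm_def
    by (intro borel_measurable_max_min fin linear_borel_measurable_std_normal_vec)
  have lim: "(\<lambda>n. \<integral>g. F n (?z \<kappa> g) \<partial>?P) \<longlonglongrightarrow> measure ?P {g \<in> space ?P. mm \<kappa> g < \<tau>}" for \<kappa>
  proof -
    have "(\<lambda>n. \<integral>g. F n (?z \<kappa> g) \<partial>?P)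
        \<longlonglongrightarrow> (\<integral>g. indicator {g \<in> space ?P. mm \<kappa> g < \<tau>} g \<partial>?P)"
    proof (rule integral_dominated_convergence[where w="\<lambda>_. 1"])
      show "(\<lambda>g. F n (?z \<kappa> g)) \<in> borel_measurable ?P" for n
        by (intro measurable_compose_family[OF measurable_F] linear_borel_measurable_std_normal_vec)
      show "AE g in ?P. (\<lambda>n. F n (?z \<kappa> g)) \<longlonglongrightarrow> indicator {g \<in> space ?P. mm \<kappa> g < \<tau>} g"
      proof (rule AE_I2)
        fix g assume "g \<in> space ?P"
        then show "(\<lambda>n. F n (?z \<kappa> g)) \<longlonglongrightarrow> indicator {g \<in> space ?P. mm \<kappa> g < \<tau>} g"
          using max_min_smoothing_tendsto[OF fin, of \<tau> "?z \<kappa> g"]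
          by (cases "mm \<kappa> g < \<tau>") (simp_all add: mm_def)
      qed
      show "AE g in ?P. norm (F n (?z \<kappa> g)) \<le> 1" for n
        using F_bounds by (intro AE_I2) (simp add: less_imp_le)
    qed auto
    then show ?thesis by simp
  qed
  show ?thesis
  proof (rule LIMSEQ_le[OF lim lim], intro exI allI impI)
    show "(\<integral>g. F n (?z \<gamma> g) \<partial>?P) \<le> (\<integral>g. F n (?z \<alpha> g) \<partial>?P)" for n
      using assms(1) orth row cross by (rule expectation_F_le)
  qed
qed

section \<open>From stochastic order to exponential moments\<close>

text \<open>Layer-cake argument: expectations of nonnegative variables are integrals of their tails.
  Working with the nonnegative integral first makes integrability of \<open>f\<close> a
  conclusion.\<close>

lemma (in prob_space) expectation_mono_stochastic_order:
  fixes f g :: "'a \<Rightarrow> real"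
  assumes [measurable]: "f \<in> borel_measurable M" and g: "integrable M g"
    and nonneg: "\<And>w. 0 \<le> f w" "\<And>w. 0 \<le> g w"
    and cdf: "\<And>u. measure M {w \<in> space M. g w < u} \<le> measure M {w \<in> space M. f w < u}"
  shows "integrable M f" "expectation f \<le> expectation g"
proof -
  interpret pair_sigma_finite lborel M ..
  have [measurable]: "g \<in> borel_measurable M" using g by auto
  \<comment> \<open>The value \<open>h w\<close> is the length of the interval from 0 to
    \<open>h w\<close>; exchanging the two integrals turns this length into a tail
    probability.\<close>
  have layer: "(\<integral>\<^sup>+w. ennreal (h w) \<partial>M)
      = (\<integral>\<^sup>+u. indicator {0..} u * emeasure M {w \<in> space M. u \<le> h w} \<partial>lborel)"
    if [measurable]: "h \<in> borel_measurable M" and "\<And>w. 0 \<le> h w" for h :: "'a \<Rightarrow> real"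
  proof -
    have "(\<integral>\<^sup>+w. ennreal (h w) \<partial>M)
        = (\<integral>\<^sup>+w. (\<integral>\<^sup>+u. indicator {0..} u * indicator {w \<in> space M. u \<le> h w} w \<partial>lborel) \<partial>M)"
    proof (rule nn_integral_cong)
      fix w assume w: "w \<in> space M"
      have "ennreal (h w) = (\<integral>\<^sup>+u. indicator {0..h w} u \<partial>lborel)"
        using that(2) by simp
      also have "\<dots> = (\<integral>\<^sup>+u. indicator {0..} u * indicator {w \<in> space M. u \<le> h w} w \<partial>lborel)"
        using w by (intro nn_integral_cong) (auto simp: indicator_def)
      finally show "ennreal (h w)
          = (\<integral>\<^sup>+u. indicator {0..} u * indicator {w \<in> space M. u \<le> h w} w \<partial>lborel)" .
    qed
    also have "\<dots> = (\<integral>\<^sup>+u. (\<integral>\<^sup>+w. indicator {0..} u * indicator {w \<in> space M. u \<le> h w} w \<partial>M) \<partial>lborel)"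
      by (rule Fubini') measurable
    also have "\<dots> = (\<integral>\<^sup>+u. indicator {0..} u * emeasure M {w \<in> space M. u \<le> h w} \<partial>lborel)"
      by (intro nn_integral_cong) (simp add: nn_integral_cmult)
    finally show ?thesis .
  qed
  \<comment> \<open>The event \<open>u \<le> h w\<close> is the exact complement of the strict event
    \<open>h w < u\<close> in \<open>cdf\<close>, so the inequality reverses for each
    \<open>u\<close>.\<close>
  have tail: "emeasure M {w \<in> space M. u \<le> f w} \<le> emeasure M {w \<in> space M. u \<le> g w}" for u
  proof -
    have "measure M {w \<in> space M. u \<le> h w} = 1 - measure M {w \<in> space M. h w < u}"
      if [measurable]: "h \<in> borel_measurable M" for h :: "'a \<Rightarrow> real"
      using prob_neg[of "\<lambda>w. h w < u"] by (simp add: not_less)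
    then show ?thesis
      using cdf[of u] by (simp add: emeasure_eq_measure)
  qed
  have le: "(\<integral>\<^sup>+w. ennreal (f w) \<partial>M) \<le> (\<integral>\<^sup>+w. ennreal (g w) \<partial>M)"
    unfolding layer[OF \<open>f \<in> borel_measurable M\<close> nonneg(1)] layer[OF \<open>g \<in> borel_measurable M\<close> nonneg(2)]
    by (intro nn_integral_mono mult_left_mono tail) auto
  have gfin: "(\<integral>\<^sup>+w. ennreal (g w) \<partial>M) < \<infinity>"
    using g nonneg by (simp add: nn_integral_eq_integral)
  then show "integrable M f"
    using le nonneg by (intro integrableI_nonneg) auto
  show "expectation f \<le> expectation g"
    using le gfin nonneg by (simp add: integral_eq_nn_integral enn2real_mono)
qed

text \<open>Completing the square: weighting the standard normal density by
  \<open>exp (k * x)\<close> gives a constant multiple of the normal density with mean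
  \<open>k\<close>.\<close>

lemma integrable_exp_std_normal: "integrable std_normal (\<lambda>x. exp (k * x))"
proof -
  have "std_normal_density x * exp (k * x) = exp (k\<^sup>2 / 2) * normal_density k 1 x" for x
    unfolding normal_density_def
    by (simp add: exp_add[symmetric] exp_diff[symmetric] power2_eq_square field_simps)
  then have "integrable lborel (\<lambda>x. std_normal_density x * exp (k * x))"
    by (simp add: integrable_normal_density)
  then show ?thesis
    by (subst integrable_density) auto
qed

text \<open>The exponential of the sum factors into functions of single coordinates, and a product
  of such integrable factors is integrable for the product measure.\<close>

lemma integrable_exp_linear_std_normal_vec:
  assumes "finite S"
  shows "integrable (std_normal_vec S) (\<lambda>g. exp (\<Sum>s\<in>S. \<alpha> s * g s))"
proof -
  interpret product_sigma_finite "\<lambda>_::'a. std_normal" by (rule product_sigma_finite_std_normal)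
  show ?thesis
    unfolding exp_sum[OF assms]
    by (intro product_integrable_prod assms integrable_exp_std_normal)
qed

lemma gordon_exp_expectation_le:
  fixes \<alpha> \<gamma> :: "'a \<times> 'b \<Rightarrow> 's \<Rightarrow> real"
  assumes "finite S" and fin: "finite X" "finite Y" "X \<noteq> {}" "Y \<noteq> {}"
    and orth: "\<And>i j. i \<in> X \<times> Y \<Longrightarrow> j \<in> X \<times> Y \<Longrightarrow> (\<Sum>s\<in>S. \<alpha> i s * \<gamma> j s) = 0"
    and row: "\<And>i j. i \<in> X \<times> Y \<Longrightarrow> j \<in> X \<times> Y \<Longrightarrow> fst i = fst j \<Longrightarrow>
      (\<Sum>s\<in>S. \<alpha> i s * \<alpha> j s) = (\<Sum>s\<in>S. \<gamma> i s * \<gamma> j s)"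
    and cross: "\<And>i j. i \<in> X \<times> Y \<Longrightarrow> j \<in> X \<times> Y \<Longrightarrow> fst i \<noteq> fst j \<Longrightarrow>
      (\<Sum>s\<in>S. \<gamma> i s * \<gamma> j s) \<le> (\<Sum>s\<in>S. \<alpha> i s * \<alpha> j s)"
    and "0 < k"
  defines "mm \<equiv> \<lambda>\<kappa> g. MAX a\<in>X. MIN b\<in>Y. \<Sum>s\<in>S. \<kappa> (a, b) s * g s"
  shows "integrable (std_normal_vec S) (\<lambda>g. exp (k * mm \<alpha> g))"
    and "(\<integral>g. exp (k * mm \<alpha> g) \<partial>std_normal_vec S) \<le> (\<integral>g. exp (k * mm \<gamma> g) \<partial>std_normal_vec S)"
proof -
  let ?P = "std_normal_vec S"
  interpret P: prob_space ?P by (rule prob_space_std_normal_vec)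
  have mm[measurable]: "mm \<kappa> \<in> borel_measurable ?P" for \<kappa>
    unfolding mm_def
    by (intro borel_measurable_max_min fin linear_borel_measurable_std_normal_vec)
  have cdf: "measure ?P {g \<in> space ?P. exp (k * mm \<gamma> g) < u}
      \<le> measure ?P {g \<in> space ?P. exp (k * mm \<alpha> g) < u}" for u
  proof (cases "u > 0")
    case True
    \<comment> \<open>Since \<open>k > 0\<close>, the map is increasing, and a level
      \<open>u > 0\<close> of the exponential corresponds to the level \<open>ln u / k\<close> of
      the max-min. For \<open>u \<le> 0\<close> both events are empty.\<close>
    have "exp (k * v) < u \<longleftrightarrow> v < ln u / k" for v
    proof -
      have "exp (k * v) < u \<longleftrightarrow> exp (k * v) < exp (ln u)"
        using True by simp
      also have "\<dots> \<longleftrightarrow> v < ln u / k"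
        unfolding exp_less_cancel_iff using \<open>0 < k\<close> by (simp add: field_simps)
      finally show ?thesis .
    qed
    moreover have "measure ?P {g \<in> space ?P. mm \<gamma> g < ln u / k}
        \<le> measure ?P {g \<in> space ?P. mm \<alpha> g < ln u / k}"
      unfolding mm_def using assms(1) fin orth row cross by (rule gordon_cdf_le)
    ultimately show ?thesis by (simp only:)
  next
    case False
    then have "\<not> exp (k * v) < u" for v
      using exp_gt_zero[of "k * v"] by linarith
    then show ?thesis by simp
  qed
  \<comment> \<open>Any fixed column serves: the max-min is at most the largest entry of column
    \<open>b\<close>, so its exponential is dominated by a finite sum of exponentials of linear
    forms.\<close>
  obtain b where b: "b \<in> Y" using fin by blast
  have int: "integrable ?P (\<lambda>g. exp (k * mm \<gamma> g))"
  proof (rule Bochner_Integration.integrable_bound)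
    show "integrable ?P (\<lambda>g. \<Sum>a\<in>X. exp (\<Sum>s\<in>S. (k * \<gamma> (a, b) s) * g s))"
      using integrable_exp_linear_std_normal_vec[OF assms(1)] by (intro Bochner_Integration.integrable_sum)
    have "exp (k * mm \<gamma> g) \<le> (\<Sum>a\<in>X. exp (\<Sum>s\<in>S. (k * \<gamma> (a, b) s) * g s))" for g
    proof -
      have "mm \<gamma> g \<in> (\<lambda>a. MIN b\<in>Y. \<Sum>s\<in>S. \<gamma> (a, b) s * g s) ` X"
        unfolding mm_def using fin by (intro Max_in) auto
      then obtain a where a: "a \<in> X" "mm \<gamma> g = (MIN b\<in>Y. \<Sum>s\<in>S. \<gamma> (a, b) s * g s)" by blast
      have "mm \<gamma> g \<le> (\<Sum>s\<in>S. \<gamma> (a, b) s * g s)"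
        unfolding a(2) using fin b by (intro Min_le) auto
      then have "exp (k * mm \<gamma> g) \<le> exp (k * (\<Sum>s\<in>S. \<gamma> (a, b) s * g s))"
        using \<open>0 < k\<close> by simp
      also have "\<dots> = exp (\<Sum>s\<in>S. (k * \<gamma> (a, b) s) * g s)"
        by (simp add: sum_distrib_left mult.assoc)
      also have "\<dots> \<le> (\<Sum>a\<in>X. exp (\<Sum>s\<in>S. (k * \<gamma> (a, b) s) * g s))"
        using fin a(1) by (intro member_le_sum) auto
      finally show ?thesis .
    qed
    then show "AE g in ?P. norm (exp (k * mm \<gamma> g))
        \<le> norm (\<Sum>a\<in>X. exp (\<Sum>s\<in>S. (k * \<gamma> (a, b) s) * g s))"
      by (intro AE_I2) (simp add: order_trans[OF _ abs_ge_self])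
  qed measurable
  have "(\<lambda>g. exp (k * mm \<alpha> g)) \<in> borel_measurable ?P" by measurable
  from P.expectation_mono_stochastic_order[OF this int exp_ge_zero exp_ge_zero cdf]
  show "integrable ?P (\<lambda>g. exp (k * mm \<alpha> g))"
    "(\<integral>g. exp (k * mm \<alpha> g) \<partial>?P) \<le> (\<integral>g. exp (k * mm \<gamma> g) \<partial>?P)" .
qed

subsection \<open>The two bilinear processes\<close>

lemma UNIV_component_index:
  "(UNIV :: ('m, 'n) component_index set)
    = insert Ix_u4 (range (case_prod Ix_G) \<union> range Ix_u2 \<union> range Ix_h)"
proof -
  have "s \<in> insert Ix_u4 (range (case_prod Ix_G) \<union> range Ix_u2 \<union> range Ix_h)"
    for s :: "('m, 'n) component_index"
    by (cases s) (auto simp: image_iff)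
  then show ?thesis by blast
qed

lemma finite_component_index: "finite (UNIV :: ('m::finite, 'n::finite) component_index set)"
  unfolding UNIV_component_index by simp

text \<open>The constructors have disjoint ranges, so the sum splits into the blocks of
  \<open>G\<close>, \<open>u4\<close>, \<open>u2\<close> and \<open>h\<close>. The covariance
  computations reduce to these blocks.\<close>

lemma sum_component_index:
  fixes f :: "('m::finite, 'n::finite) component_index \<Rightarrow> real"
  shows "(\<Sum>s\<in>UNIV. f s)
    = (\<Sum>i\<in>UNIV. \<Sum>j\<in>UNIV. f (Ix_G i j)) + f Ix_u4 + (\<Sum>i\<in>UNIV. f (Ix_u2 i)) + (\<Sum>j\<in>UNIV. f (Ix_h j))"
proof -
  have "(\<Sum>s\<in>UNIV. f s) = f Ix_u4 + (sum f (range (case_prod Ix_G)) + sum f (range Ix_u2) + sum f (range Ix_h))"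
    unfolding UNIV_component_index
    by (subst sum.insert; (subst sum.union_disjoint)?; (subst sum.union_disjoint)?; auto)
  moreover have "sum f (range (case_prod Ix_G)) = (\<Sum>i\<in>UNIV. \<Sum>j\<in>UNIV. f (Ix_G i j))"
    by (subst sum.reindex) (auto simp: inj_on_def sum.cartesian_product intro!: sum.cong)
  moreover have "sum f (range Ix_u2) = (\<Sum>i\<in>UNIV. f (Ix_u2 i))"
    "sum f (range Ix_h) = (\<Sum>j\<in>UNIV. f (Ix_h j))"
    by (subst sum.reindex; simp add: inj_on_def)+
  ultimately show ?thesis by simp
qed

text \<open>A pair \<open>p\<close> consists of a vector of \<open>X\<close> (the row index, over
  which the maximum runs) and a vector of \<open>Y\<close>. The zeros on \<open>Ix_u2\<close> and
  \<open>Ix_h\<close> keep the support disjoint from that of \<open>decoupled_coeff\<close>, which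
  gives the orthogonality.\<close>

primrec bilinear_coeff :: "(real ^ 'n) \<times> (real ^ 'm) \<Rightarrow> ('m, 'n) component_index \<Rightarrow> real" where
  "bilinear_coeff p (Ix_G i j) = snd p $ i * fst p $ j"
| "bilinear_coeff p Ix_u4 = norm (fst p) * norm (snd p)"
| "bilinear_coeff p (Ix_u2 i) = 0"
| "bilinear_coeff p (Ix_h j) = 0"

primrec decoupled_coeff :: "(real ^ 'n) \<times> (real ^ 'm) \<Rightarrow> ('m, 'n) component_index \<Rightarrow> real" where
  "decoupled_coeff p (Ix_G i j) = 0"
| "decoupled_coeff p Ix_u4 = 0"
| "decoupled_coeff p (Ix_u2 i) = norm (fst p) * snd p $ i"
| "decoupled_coeff p (Ix_h j) = norm (snd p) * fst p $ j"

lemma sum_bilinear_coeff: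
  fixes p q :: "(real ^ 'n) \<times> (real ^ 'm)"
  shows "(\<Sum>s\<in>UNIV. bilinear_coeff p s * bilinear_coeff q s)
    = (snd p \<bullet> snd q) * (fst p \<bullet> fst q) + norm (fst p) * norm (snd p) * (norm (fst q) * norm (snd q))"
  by (simp add: sum_component_index inner_vec_def sum_product mult_ac)

lemma sum_decoupled_coeff:
  fixes p q :: "(real ^ 'n) \<times> (real ^ 'm)"
  shows "(\<Sum>s\<in>UNIV. decoupled_coeff p s * decoupled_coeff q s)
    = norm (fst p) * norm (fst q) * (snd p \<bullet> snd q) + norm (snd p) * norm (snd q) * (fst p \<bullet> fst q)"
  by (simp add: sum_component_index inner_vec_def sum_distrib_left mult_ac)

lemma sum_bilinear_decoupled_coeff: "(\<Sum>s\<in>UNIV. bilinear_coeff p s * decoupled_coeff q s) = 0"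
  by (simp add: sum_component_index)

text \<open>The difference of the covariances factors into two Cauchy-Schwarz defects, one for the
  \<open>X\<close> vectors and one for the \<open>Y\<close> vectors.\<close>

lemma sum_decoupled_le_bilinear_coeff:
  fixes p q :: "(real ^ 'n) \<times> (real ^ 'm)"
  shows "(\<Sum>s\<in>UNIV. decoupled_coeff p s * decoupled_coeff q s)
    \<le> (\<Sum>s\<in>UNIV. bilinear_coeff p s * bilinear_coeff q s)"
proof -
  have "0 \<le> (norm (fst p) * norm (fst q) - fst p \<bullet> fst q) * (norm (snd p) * norm (snd q) - snd p \<bullet> snd q)"
    using norm_cauchy_schwarz[of "fst p" "fst q"] norm_cauchy_schwarz[of "snd p" "snd q"] by simp
  then show ?thesis
    unfolding sum_bilinear_coeff sum_decoupled_coeff by (simp add: algebra_simps)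
qed

text \<open>In a common row the inner product of the \<open>X\<close> vectors is the squared norm,
  so their Cauchy-Schwarz defect is zero. The \<open>u4\<close> term supplies the summand needed for
  this balance.\<close>

lemma sum_bilinear_coeff_eq_decoupled:
  fixes p q :: "(real ^ 'n) \<times> (real ^ 'm)"
  assumes "fst p = fst q"
  shows "(\<Sum>s\<in>UNIV. bilinear_coeff p s * bilinear_coeff q s)
    = (\<Sum>s\<in>UNIV. decoupled_coeff p s * decoupled_coeff q s)"
  unfolding sum_bilinear_coeff sum_decoupled_coeff assms
  by (simp add: dot_square_norm power2_eq_square mult_ac)

lemma sum_bilinear_coeff_component:
  fixes a :: "real ^ 'n" and b :: "real ^ 'm"
  shows "(\<Sum>s\<in>UNIV. bilinear_coeff (a, b) s * component G u4 u2 h s w)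
    = b \<bullet> (G w *v a) + norm a * norm b * u4 w"
  by (simp add: sum_component_index inner_vec_def matrix_vector_mult_def sum_distrib_left mult_ac)

lemma sum_decoupled_coeff_component:
  fixes a :: "real ^ 'n" and b :: "real ^ 'm"
  shows "(\<Sum>s\<in>UNIV. decoupled_coeff (a, b) s * component G u4 u2 h s w)
    = norm a * (b \<bullet> u2 w) + norm b * (h w \<bullet> a)"
  by (simp add: sum_component_index inner_vec_def sum_distrib_left mult_ac)

section \<open>Transfer to the canonical Gaussian space and conclusion\<close>

text \<open>Independence makes the joint law the product of the marginal laws, each of which is
  \<open>std_normal\<close>. Expectations over \<open>M\<close> thereby become integrals over the
  product space.\<close>

lemma iid_std_normal_distr:
  assumes "prob_space M" and Z: "iid_std_normal M Z"
  shows "(\<lambda>w s. Z s w) \<in> measurable M (std_normal_vec UNIV)"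
    and "distr M (std_normal_vec UNIV) (\<lambda>w s. Z s w) = std_normal_vec UNIV"
proof -
  interpret prob_space M by fact
  have ind: "indep_vars (\<lambda>_. borel) Z UNIV"
    and dist: "distributed M lborel (Z s) std_normal_density" for s
    using Z by (auto simp: iid_std_normal_def)
  have rv: "Z s \<in> borel_measurable M" for s
    using distributed_measurable[OF dist[of s]] by simp
  have sets: "sets (std_normal_vec UNIV) = sets (Pi\<^sub>M UNIV (\<lambda>_. borel))"
    by (intro sets_PiM_cong) auto
  show "(\<lambda>w s. Z s w) \<in> measurable M (std_normal_vec UNIV)"
    using rv by (intro measurable_PiM_single') auto
  have "distr M borel (Z s) = std_normal" for s
    using distributed_distr_eq_density[OF dist[of s]] distr_cong[of M M borel lborel "Z s" "Z s"] by simp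
  then have "distr M (Pi\<^sub>M UNIV (\<lambda>_. borel)) (\<lambda>w s. Z s w) = std_normal_vec UNIV"
    using iffD1[OF indep_vars_iff_distr_eq_PiM ind] rv by (simp add: restrict_def)
  then show "distr M (std_normal_vec UNIV) (\<lambda>w s. Z s w) = std_normal_vec UNIV"
    using distr_cong[OF refl sets refl, of M "\<lambda>w s. Z s w"] by simp
qed

theorem mainTheorem7:
  fixes M :: "'w measure"
    and l :: nat
    and x :: "nat \<Rightarrow> real ^ 'n"
    and y :: "nat \<Rightarrow> real ^ 'm"
    and X :: "(real ^ 'n) set"
    and Y :: "(real ^ 'm) set"
    and c3 :: real
    and G :: "'w \<Rightarrow> real ^ 'n ^ 'm"
    and u4 :: "'w \<Rightarrow> real"
    and u2 :: "'w \<Rightarrow> real ^ 'm"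
    and h :: "'w \<Rightarrow> real ^ 'n"
  assumes "prob_space M"
    and "l \<ge> 1"
    and "X = x ` {1..l}"
    and "Y = y ` {1..l}"
    and "c3 > 0"
    and "iid_std_normal M (component G u4 u2 h)"
  shows "ln (prob_space.expectation M (\<lambda>w.
           exp (c3 * (MAX a\<in>X. MIN b\<in>Y. b \<bullet> (G w *v a) + norm a * norm b * u4 w))))
       \<le> ln (prob_space.expectation M (\<lambda>w.
           exp (c3 * (MAX a\<in>X. MIN b\<in>Y. norm a * (b \<bullet> u2 w) + norm b * (h w \<bullet> a)))))"
proof -
  interpret prob_space M by fact
  let ?P = "std_normal_vec UNIV :: (('m, 'n) component_index \<Rightarrow> real) measure"
  define mm where "mm \<kappa> g = (MAX a\<in>X. MIN b\<in>Y. \<Sum>s\<in>UNIV. \<kappa> (a, b) s * g s)"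
    for \<kappa> :: "(real ^ 'n) \<times> (real ^ 'm) \<Rightarrow> ('m, 'n) component_index \<Rightarrow> real" and g
  \<comment> \<open>The condition \<open>l \<ge> 1\<close> makes both sets nonempty, so
    \<open>MAX\<close> and \<open>MIN\<close> are taken over nonempty finite sets.\<close>
  have fin: "finite X" "finite Y" "X \<noteq> {}" "Y \<noteq> {}"
    using assms(2-4) by auto
  have gordon: "integrable ?P (\<lambda>g. exp (c3 * mm bilinear_coeff g))"
    "(\<integral>g. exp (c3 * mm bilinear_coeff g) \<partial>?P) \<le> (\<integral>g. exp (c3 * mm decoupled_coeff g) \<partial>?P)"
    unfolding mm_def
    using gordon_exp_expectation_le[of UNIV _ _ bilinear_coeff decoupled_coeff, OF finite_component_index fin sum_bilinear_decoupled_coeff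
        sum_bilinear_coeff_eq_decoupled sum_decoupled_le_bilinear_coeff \<open>c3 > 0\<close>]
    by auto
  have meas: "(\<lambda>g. exp (c3 * mm \<kappa> g)) \<in> borel_measurable ?P" for \<kappa>
    unfolding mm_def
    by (intro borel_measurable_exp[THEN measurable_compose[rotated]] borel_measurable_times
        borel_measurable_const borel_measurable_max_min fin linear_borel_measurable_std_normal_vec)
  note Z = iid_std_normal_distr[OF assms(1,6)]
  have transfer: "expectation (\<lambda>w. exp (c3 * mm \<kappa> (\<lambda>s. component G u4 u2 h s w)))
      = (\<integral>g. exp (c3 * mm \<kappa> g) \<partial>?P)" for \<kappa>
    using integral_distr[OF Z(1) meas[of \<kappa>]] unfolding Z(2) by simp
  interpret P: prob_space ?P by (rule prob_space_std_normal_vec)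
  \<comment> \<open>Monotonicity of \<open>ln\<close> is applied with a positive smaller argument.
    The integrand is strictly positive and, by \<open>gordon(1)\<close>, integrable, so its integral
    is positive.\<close>
  have "0 < (\<integral>g. exp (c3 * mm bilinear_coeff g) \<partial>?P)"
    using P.integral_less_AE_space[of "\<lambda>_. 0" "\<lambda>g. exp (c3 * mm bilinear_coeff g)"] gordon(1)
    by (simp add: P.emeasure_space_1)
  then have "ln (\<integral>g. exp (c3 * mm bilinear_coeff g) \<partial>?P) \<le> ln (\<integral>g. exp (c3 * mm decoupled_coeff g) \<partial>?P)"
    by (rule ln_mono[OF gordon(2)])
  then show ?thesis
    unfolding transfer[symmetric] unfolding mm_def sum_bilinear_coeff_component sum_decoupled_coeff_component .
qed

end
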